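(* Let $\mathcal{H}_1,\dots,\mathcal{H}_n$ be complex Hilbert spaces and let $S_j\in\mathcal{B}(\mathcal{H}_j,\mathcal{H}_1)$ for $1\le j\le n$. Then the operator matrix acting on $\bigoplus_{j=1}^n\mathcal{H}_j$ whose first row is $(S_1,S_2,\dots,S_n)$ and whose other rows are zero satisfies $$\omega\left(\begin{bmatrix} S_1 & S_2 & \cdots & S_n\\ 0 & 0 & \cdots & 0\\ \vdots & \vdots & & \vdots\\ 0 & 0&\cdots & 0\end{bmatrix}\right)\le \frac12\left(\omega(S_1)+\left(\omega^2(S_1)+\sum_{j=2}^{n}\|S_j\|^2\right)^{1/2}\right).$$
   Context: $\mathcal{B}(\mathcal{H}_j,\mathcal{H}_i)$ is the space of bounded linear operators from $\mathcal{H}_j$ to $\mathcal{H}_i$, and $\|\cdot\|$ is the operator norm. The numerical radius of a bounded operator $A$ on a complex Hilbert space is $\omega(A)=\sup_{\|x\|=1}|\langle Ax,x\rangle|$, and $\omega^2(A)=(\omega(A))^2$. *)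

theory Defs
  imports "HOL-Analysis.Analysis" "HOL-Algebra.Algebraic_Closure_Type"
begin

text \<open>
  Hilbert spaces are carrier-based, so that a family of pairwise different spaces
  can be indexed by a natural number. The vector space structure is that of a
  \<^locale>\<open>Module.module\<close> over the field of complex numbers; the fields \<open>mult\<close> and \<open>one\<close>,
  which the record type inherits from rings, play no role.
\<close>

record 'a complex_ip = "(complex, 'a) module" +
  cip :: "'a \<Rightarrow> 'a \<Rightarrow> complex"

definition hnorm :: "('a, 'b) complex_ip_scheme \<Rightarrow> 'a \<Rightarrow> real" where
  "hnorm H x = sqrt (Re (cip H x x))"

text \<open>
  \<^locale>\<open>Metric_space\<close> requires nonnegativity and symmetry of the distance also for points
  outside the space, so the distance is set to 0 there.
\<close>

definition hdist :: "('a, 'b) complex_ip_scheme \<Rightarrow> 'a \<Rightarrow> 'a \<Rightarrow> real" where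
  "hdist H x y = (if x \<in> carrier H \<and> y \<in> carrier H then hnorm H (x \<ominus>\<^bsub>H\<^esub> y) else 0)"

text \<open>The inner product is linear in its first argument.\<close>

locale complex_hilbert_space =
  Module.module "ring_of_type_algebra :: complex ring" H for H :: "('a, 'b) complex_ip_scheme" (structure) +
  assumes cip_add_left:
      "\<lbrakk>x \<in> carrier H; y \<in> carrier H; z \<in> carrier H\<rbrakk> \<Longrightarrow> cip H (x \<oplus> y) z = cip H x z + cip H y z"
    and cip_smult_left:
      "\<lbrakk>x \<in> carrier H; y \<in> carrier H\<rbrakk> \<Longrightarrow> cip H (c \<odot>\<^bsub>H\<^esub> x) y = c * cip H x y"
    and cip_commute:
      "\<lbrakk>x \<in> carrier H; y \<in> carrier H\<rbrakk> \<Longrightarrow> cip H y x = cnj (cip H x y)"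
    and cip_ge_zero: "x \<in> carrier H \<Longrightarrow> 0 \<le> Re (cip H x x)"
    and cip_eq_zero: "\<lbrakk>x \<in> carrier H; cip H x x = 0\<rbrakk> \<Longrightarrow> x = \<zero>"
    and complete: "Metric_space.mcomplete (carrier H) (hdist H)"

lemma (in complex_hilbert_space) cip_add_right:
  assumes "x \<in> carrier H" "y \<in> carrier H" "z \<in> carrier H"
  shows "cip H x (y \<oplus> z) = cip H x y + cip H x z"
proof -
  have "cip H x (y \<oplus> z) = cnj (cip H (y \<oplus> z) x)"
    using assms by (intro cip_commute) auto
  also have "\<dots> = cnj (cip H y x) + cnj (cip H z x)"
    using assms by (simp add: cip_add_left)
  finally show ?thesis
    using assms cip_commute by metis
qed

lemma (in complex_hilbert_space) cip_smult_right:
  assumes "x \<in> carrier H" "y \<in> carrier H"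
  shows "cip H x (c \<odot>\<^bsub>H\<^esub> y) = cnj c * cip H x y"
proof -
  have c: "c \<in> carrier (ring_of_type_algebra :: complex ring)"
    by (simp add: ring_of_type_algebra_def)
  have "cip H x (c \<odot>\<^bsub>H\<^esub> y) = cnj (cip H (c \<odot>\<^bsub>H\<^esub> y) x)"
    using assms c by (intro cip_commute) auto
  also have "\<dots> = cnj c * cnj (cip H y x)"
    using assms by (simp add: cip_smult_left)
  finally show ?thesis
    using assms cip_commute by metis
qed

lemma (in complex_hilbert_space) cip_zero:
  assumes "x \<in> carrier H"
  shows "cip H \<zero> x = 0" "cip H x \<zero> = 0"
  using cip_add_left[of "\<zero>" "\<zero>" x] cip_add_right[of x "\<zero>" "\<zero>"] assms by auto

lemma (in complex_hilbert_space) cip_minus: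
  assumes "x \<in> carrier H" "y \<in> carrier H"
  shows "cip H (\<ominus> x) y = - cip H x y" "cip H y (\<ominus> x) = - cip H y x"
  using cip_add_left[of x "\<ominus> x" y] cip_add_right[of y x "\<ominus> x"] cip_zero[of y] assms
  by (auto simp: M.r_neg add_eq_0_iff)

lemma (in complex_hilbert_space) Re_cip_le:
  assumes x: "x \<in> carrier H" and y: "y \<in> carrier H"
  shows "\<bar>Re (cip H x y)\<bar> \<le> hnorm H x * hnorm H y"
proof (cases "cip H y y = 0")
  case True
  then have "y = \<zero>" using cip_eq_zero y by blast
  then show ?thesis using cip_zero[OF x] cip_zero[of "\<zero>"] by (simp add: hnorm_def)
next
  case False
  have im: "Im (cip H y y) = 0"
    using cip_commute[OF y y] by (simp add: complex_eq_iff)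
  define p q r where "p = Re (cip H x x)" and "q = Re (cip H y y)" and "r = Re (cip H x y)"
  have q: "q > 0"
    using False im cip_ge_zero[OF y] unfolding q_def
    by (simp add: complex_eq_iff less_le)
  define c where "c = complex_of_real (- r / q)"
  have c: "c \<in> carrier (ring_of_type_algebra :: complex ring)"
    by (simp add: ring_of_type_algebra_def)
  define z where "z = c \<odot>\<^bsub>H\<^esub> y"
  have z: "z \<in> carrier H" using c y by (simp add: z_def)
  have yx: "Re (cip H y x) = r"
    using cip_commute[OF x y] by (simp add: r_def)
  have xz: "Re (cip H x z) = - r / q * r"
    unfolding z_def cip_smult_right[OF x y] c_def r_def by simp
  have zx: "Re (cip H z x) = - r / q * r"
    unfolding z_def cip_smult_left[OF y x] c_def using yx by simp
  have zz: "Re (cip H z z) = (- r / q)\<^sup>2 * q"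
    using z unfolding z_def c_def
    by (simp add: cip_smult_left cip_smult_right y z[unfolded z_def c_def] q_def power2_eq_square)
  have "0 \<le> Re (cip H (x \<oplus> z) (x \<oplus> z))"
    using x z by (intro cip_ge_zero) auto
  also have "\<dots> = p + 2 * (- r / q * r) + (- r / q)\<^sup>2 * q"
    using x z xz zx zz by (simp add: cip_add_left cip_add_right p_def)
  also have "\<dots> = p - r\<^sup>2 / q"
    using q by (simp add: power2_eq_square field_simps)
  finally have "r\<^sup>2 \<le> p * q"
    using q by (simp add: field_simps)
  then have "sqrt (r\<^sup>2) \<le> sqrt (p * q)"
    by (rule real_sqrt_le_mono)
  then show ?thesis
    by (simp add: hnorm_def real_sqrt_mult p_def q_def r_def)
qed

lemma (in complex_hilbert_space) hnorm_add_le: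
  assumes x: "x \<in> carrier H" and y: "y \<in> carrier H"
  shows "hnorm H (x \<oplus> y) \<le> hnorm H x + hnorm H y"
proof (rule power2_le_imp_le)
  have sq: "(hnorm H u)\<^sup>2 = Re (cip H u u)" if "u \<in> carrier H" for u
    using cip_ge_zero[OF that] by (simp add: hnorm_def)
  have yx: "Re (cip H y x) = Re (cip H x y)"
    using cip_commute[OF x y] by simp
  have "(hnorm H (x \<oplus> y))\<^sup>2 = (hnorm H x)\<^sup>2 + 2 * Re (cip H x y) + (hnorm H y)\<^sup>2"
    using x y yx by (simp add: sq cip_add_left cip_add_right)
  also have "\<dots> \<le> (hnorm H x)\<^sup>2 + 2 * (hnorm H x * hnorm H y) + (hnorm H y)\<^sup>2"
    using Re_cip_le[OF x y] by simp
  finally show "(hnorm H (x \<oplus> y))\<^sup>2 \<le> (hnorm H x + hnorm H y)\<^sup>2"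
    by (simp add: power2_sum)
  show "0 \<le> hnorm H x + hnorm H y"
    using cip_ge_zero[OF x] cip_ge_zero[OF y] by (simp add: hnorm_def)
qed

lemma (in complex_hilbert_space) Metric_space_hdist: "Metric_space (carrier H) (hdist H)"
proof
  show "0 \<le> hdist H x y" for x y
    using cip_ge_zero[of "x \<ominus> y"] by (simp add: hdist_def hnorm_def)
  show "hdist H x y = hdist H y x" for x y
  proof (cases "x \<in> carrier H \<and> y \<in> carrier H")
    case True
    then have "x \<ominus> y = \<ominus> (y \<ominus> x)"
      by (simp add: a_minus_def M.minus_add M.a_comm)
    then show ?thesis
      using True by (simp add: hdist_def hnorm_def cip_minus)
  qed (auto simp: hdist_def)
  show "(hdist H x y = 0) = (x = y)" if "x \<in> carrier H" "y \<in> carrier H" for x y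
  proof -
    have d: "x \<ominus> y \<in> carrier H" using that by simp
    have "hdist H x y = 0 \<longleftrightarrow> cip H (x \<ominus> y) (x \<ominus> y) = 0"
      using that cip_commute[OF d d] by (auto simp: hdist_def hnorm_def complex_eq_iff)
    also have "\<dots> \<longleftrightarrow> x \<ominus> y = \<zero>"
      using cip_eq_zero[OF d] cip_zero by auto
    also have "\<dots> \<longleftrightarrow> x = y"
      using that by (metis M.minus_equality M.minus_minus M.r_neg M.a_inv_closed a_minus_def)
    finally show ?thesis .
  qed
  show "hdist H x z \<le> hdist H x y + hdist H y z"
    if "x \<in> carrier H" "y \<in> carrier H" "z \<in> carrier H" for x y z
  proof -
    have "(x \<ominus> y) \<oplus> (y \<ominus> z) = x \<oplus> ((\<ominus> y \<oplus> y) \<ominus> z)"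
      using that by (simp add: a_minus_def M.a_assoc)
    also have "\<dots> = x \<ominus> z"
      using that by (simp add: M.l_neg a_minus_def)
    finally have "x \<ominus> z = (x \<ominus> y) \<oplus> (y \<ominus> z)" ..
    then show ?thesis
      using that hnorm_add_le[of "x \<ominus> y" "y \<ominus> z"] by (simp add: hdist_def)
  qed
qed

definition bounded_operators ::
    "('a, 'b) complex_ip_scheme \<Rightarrow> ('c, 'd) complex_ip_scheme \<Rightarrow> ('a \<Rightarrow> 'c) set" where
  "bounded_operators H K =
    {T. T \<in> carrier H \<rightarrow> carrier K \<and>
        (\<forall>x\<in>carrier H. \<forall>y\<in>carrier H. T (x \<oplus>\<^bsub>H\<^esub> y) = T x \<oplus>\<^bsub>K\<^esub> T y) \<and>
        (\<forall>c. \<forall>x\<in>carrier H. T (c \<odot>\<^bsub>H\<^esub> x) = c \<odot>\<^bsub>K\<^esub> T x) \<and>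
        (\<exists>C. \<forall>x\<in>carrier H. hnorm K (T x) \<le> C * hnorm H x)}"

definition operator_norm ::
    "('a, 'b) complex_ip_scheme \<Rightarrow> ('c, 'd) complex_ip_scheme \<Rightarrow> ('a \<Rightarrow> 'c) \<Rightarrow> real" where
  "operator_norm H K T = (SUP x\<in>{x \<in> carrier H. hnorm H x \<le> 1}. hnorm K (T x))"

text \<open>
  Inserting 0 does not change the supremum of a nonempty set of nonnegative reals. It
  only makes the numerical radius 0 on the zero space, which has no unit vectors and
  where the supremum of the empty set of reals would be unspecified.
\<close>

definition numerical_radius :: "('a, 'b) complex_ip_scheme \<Rightarrow> ('a \<Rightarrow> 'a) \<Rightarrow> real" where
  "numerical_radius H A = Sup (insert 0 {cmod (cip H (A x) x) | x. x \<in> carrier H \<and> hnorm H x = 1})"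

definition direct_sum :: "'i set \<Rightarrow> ('i \<Rightarrow> 'a complex_ip) \<Rightarrow> ('i \<Rightarrow> 'a) complex_ip" where
  "direct_sum I H =
    \<lparr>carrier = (\<Pi>\<^sub>E i\<in>I. carrier (H i)),
     monoid.mult = undefined,
     one = undefined,
     zero = (\<lambda>i\<in>I. \<zero>\<^bsub>H i\<^esub>),
     add = (\<lambda>x y. \<lambda>i\<in>I. x i \<oplus>\<^bsub>H i\<^esub> y i),
     smult = (\<lambda>c x. \<lambda>i\<in>I. c \<odot>\<^bsub>H i\<^esub> x i),
     cip = (\<lambda>x y. \<Sum>i\<in>I. cip (H i) (x i) (y i))\<rparr>"

text \<open>The entry \<open>T i j\<close> of an operator matrix maps \<open>H j\<close> to \<open>H i\<close>.\<close>

definition operator_matrix ::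
    "'i set \<Rightarrow> ('i \<Rightarrow> 'a complex_ip) \<Rightarrow> ('i \<Rightarrow> 'i \<Rightarrow> 'a \<Rightarrow> 'a) \<Rightarrow> ('i \<Rightarrow> 'a) \<Rightarrow> ('i \<Rightarrow> 'a)" where
  "operator_matrix I H T x = (\<lambda>i\<in>I. \<Oplus>\<^bsub>H i\<^esub>j\<in>I. T i j (x j))"

end

theory Submission
  imports Defs
begin

text \<open>
  For a unit vector \<open>x\<close> put \<open>a = \<parallel>x\<^sub>1\<parallel>\<close> and \<open>b = sqrt (1 - a\<^sup>2)\<close>. With \<open>w = \<omega>(S\<^sub>1)\<close> and
  \<open>v = sqrt (\<Sum>j=2..n. \<parallel>S\<^sub>j\<parallel>\<^sup>2)\<close>, the Cauchy--Schwarz inequality in \<open>H\<^sub>1\<close> and in \<open>\<real>\<^bsup>n-1\<^esup>\<close> bounds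
  the quadratic form by \<open>w a\<^sup>2 + v a b\<close>. Since \<open>(2 a\<^sup>2 - 1, 2 a b)\<close> is a unit vector in the plane,
  one more Cauchy--Schwarz gives \<open>w (2 a\<^sup>2 - 1) + 2 v a b \<le> sqrt (w\<^sup>2 + v\<^sup>2)\<close>.
\<close>

lemma quadratic_form_bound:
  fixes a b v w :: real
  assumes "a\<^sup>2 + b\<^sup>2 = 1"
  shows "w * a\<^sup>2 + v * (a * b) \<le> 1 / 2 * (w + sqrt (w\<^sup>2 + v\<^sup>2))"
proof -
  \<comment> \<open>The first coordinate 2 a^2 - 1 is written as a^2 - b^2, which makes this a
    polynomial identity, the double-angle formula for a = cos, b = sin.\<close>
  have "(a\<^sup>2 - b\<^sup>2)\<^sup>2 + (2 * (a * b))\<^sup>2 = (a\<^sup>2 + b\<^sup>2)\<^sup>2"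
    by (simp add: power2_eq_square algebra_simps)
  then have unit: "(a\<^sup>2 - b\<^sup>2)\<^sup>2 + (2 * (a * b))\<^sup>2 = 1"
    using assms by simp
  have "w * (a\<^sup>2 - b\<^sup>2) + v * (2 * (a * b)) \<le> sqrt (w\<^sup>2 + v\<^sup>2)"
  proof (rule real_le_rsqrt)
    \<comment> \<open>Lagrange's identity in the plane; dropping the second square leaves
      Cauchy-Schwarz.\<close>
    have "(w * (a\<^sup>2 - b\<^sup>2) + v * (2 * (a * b)))\<^sup>2 + (w * (2 * (a * b)) - v * (a\<^sup>2 - b\<^sup>2))\<^sup>2
        = (w\<^sup>2 + v\<^sup>2) * ((a\<^sup>2 - b\<^sup>2)\<^sup>2 + (2 * (a * b))\<^sup>2)"
      by (simp add: power2_eq_square algebra_simps)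
    then show "(w * (a\<^sup>2 - b\<^sup>2) + v * (2 * (a * b)))\<^sup>2 \<le> w\<^sup>2 + v\<^sup>2"
      unfolding unit by (smt (verit) mult_cancel_left2 zero_le_power2 mult.right_neutral)
  qed
  moreover have "w * (a\<^sup>2 - b\<^sup>2) = 2 * (w * a\<^sup>2) - w"
    using arg_cong[OF assms, of "\<lambda>t. w * t"] by (simp add: algebra_simps)
  ultimately show ?thesis by simp
qed

context complex_hilbert_space
begin

lemma hnorm_ge_zero: "x \<in> carrier H \<Longrightarrow> 0 \<le> hnorm H x"
  by (simp add: hnorm_def cip_ge_zero)

lemma hnorm_square: "x \<in> carrier H \<Longrightarrow> (hnorm H x)\<^sup>2 = Re (cip H x x)"
  by (simp add: hnorm_def cip_ge_zero)

lemma smult_in_carrier: "x \<in> carrier H \<Longrightarrow> c \<odot>\<^bsub>H\<^esub> x \<in> carrier H"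
  by (simp add: ring_of_type_algebra_def)

lemma hnorm_smult:
  assumes "x \<in> carrier H"
  shows "hnorm H (c \<odot>\<^bsub>H\<^esub> x) = cmod c * hnorm H x"
proof -
  have "cip H (c \<odot>\<^bsub>H\<^esub> x) (c \<odot>\<^bsub>H\<^esub> x) = (c * cnj c) * cip H x x"
    using assms by (simp add: cip_smult_left cip_smult_right smult_in_carrier)
  then have "Re (cip H (c \<odot>\<^bsub>H\<^esub> x) (c \<odot>\<^bsub>H\<^esub> x)) = (cmod c)\<^sup>2 * Re (cip H x x)"
    by (simp add: complex_mult_cnj cmod_power2)
  then show ?thesis
    by (simp add: hnorm_def real_sqrt_mult)
qed

text \<open>Multiplying \<open>x\<close> by a scalar of modulus 1 makes the inner product real and
  nonnegative without changing \<open>hnorm H x\<close>, so the bound on real parts in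
  \<open>Re_cip_le\<close> suffices.\<close>

lemma cmod_cip_le:
  assumes "x \<in> carrier H" "y \<in> carrier H"
  shows "cmod (cip H x y) \<le> hnorm H x * hnorm H y"
proof (cases "cip H x y = 0")
  case True
  then show ?thesis using assms by (simp add: hnorm_ge_zero)
next
  case False
  define c where "c = cnj (sgn (cip H x y))"
  have c: "cmod c = 1"
    using False by (simp add: c_def norm_sgn)
  have "c * cip H x y = complex_of_real (cmod (cip H x y))"
    using False unfolding c_def sgn_eq
    by (simp add: field_simps complex_norm_square[symmetric] power2_eq_square)
  then have "cmod (cip H x y) = Re (cip H (c \<odot>\<^bsub>H\<^esub> x) y)"
    using assms by (simp add: cip_smult_left)
  also have "\<dots> \<le> hnorm H (c \<odot>\<^bsub>H\<^esub> x) * hnorm H y"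
    using Re_cip_le[OF smult_in_carrier[OF assms(1)] assms(2)] by (rule abs_le_D1)
  finally show ?thesis
    using assms by (simp add: hnorm_smult c)
qed

lemma cip_finsum_left:
  assumes "finite I" "\<And>i. i \<in> I \<Longrightarrow> f i \<in> carrier H" "y \<in> carrier H"
  shows "cip H (\<Oplus>i\<in>I. f i) y = (\<Sum>i\<in>I. cip H (f i) y)"
  using assms(1,2)
proof (induction I)
  case empty
  then show ?case using assms(3) by (simp add: cip_zero)
next
  case (insert i I)
  then have "(\<Oplus>j\<in>insert i I. f j) = f i \<oplus> (\<Oplus>j\<in>I. f j)"
    by (intro M.finsum_insert) auto
  then show ?case
    using insert assms(3) by (simp add: cip_add_left M.finsum_closed Pi_iff)
qed

text \<open>By homogeneity, this factorization carries bounds from unit vectors, where the suprema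
  are taken, to vectors of any nonzero norm.\<close>

lemma normalize:
  assumes "x \<in> carrier H" "hnorm H x \<noteq> 0"
  obtains u where "u \<in> carrier H" "hnorm H u = 1" "x = complex_of_real (hnorm H x) \<odot>\<^bsub>H\<^esub> u"
proof
  let ?u = "complex_of_real (1 / hnorm H x) \<odot>\<^bsub>H\<^esub> x"
  show "?u \<in> carrier H"
    by (rule smult_in_carrier[OF assms(1)])
  show "hnorm H ?u = 1"
    using assms hnorm_ge_zero[OF assms(1)] by (simp add: hnorm_smult norm_divide)
  have "complex_of_real (hnorm H x) \<odot>\<^bsub>H\<^esub> ?u
      = (complex_of_real (hnorm H x) * complex_of_real (1 / hnorm H x)) \<odot>\<^bsub>H\<^esub> x"
    using smult_assoc1[of "complex_of_real (hnorm H x)" "complex_of_real (1 / hnorm H x)" x] assms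
    by (simp add: ring_of_type_algebra_def)
  also have "\<dots> = x"
    using smult_one[OF assms(1)] assms by (simp add: ring_of_type_algebra_def)
  finally show "x = complex_of_real (hnorm H x) \<odot>\<^bsub>H\<^esub> ?u" ..
qed

text \<open>The quadratic form of \<open>A\<close> scales by the square of the norm, so the supremum
  over unit vectors controls it everywhere.\<close>

lemma numerical_radius_upper:
  assumes A: "A \<in> bounded_operators H H" and x: "x \<in> carrier H"
  shows "cmod (cip H (A x) x) \<le> numerical_radius H A * (hnorm H x)\<^sup>2"
proof (cases "hnorm H x = 0")
  case True
  have "A x \<in> carrier H"
    using A x by (auto simp: bounded_operators_def)
  from cmod_cip_le[OF this x] show ?thesis
    by (simp add: True)
next
  case False
  then obtain u where u: "u \<in> carrier H" "hnorm H u = 1"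
    and xu: "x = complex_of_real (hnorm H x) \<odot>\<^bsub>H\<^esub> u"
    using normalize[OF x] by blast
  define r where "r = hnorm H x"
  obtain C where C: "\<And>y. y \<in> carrier H \<Longrightarrow> hnorm H (A y) \<le> C * hnorm H y"
    using A unfolding bounded_operators_def by blast
  have Ac: "A y \<in> carrier H" if "y \<in> carrier H" for y
    using A that by (auto simp: bounded_operators_def)
  \<comment> \<open>Boundedness of \<open>A\<close> and Cauchy-Schwarz make the set in
    \<open>numerical_radius\<close> bounded above, so its supremum is an upper bound.\<close>
  have "cmod (cip H (A y) y) \<le> C" if "y \<in> carrier H" "hnorm H y = 1" for y
    using cmod_cip_le[OF Ac[OF that(1)] that(1)] C[OF that(1)] that by simp
  then have "bdd_above (insert 0 {cmod (cip H (A y) y) | y. y \<in> carrier H \<and> hnorm H y = 1})"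
    by (auto intro!: bdd_aboveI[where M = C])
  then have le: "cmod (cip H (A u) u) \<le> numerical_radius H A"
    unfolding numerical_radius_def using u by (intro cSup_upper) auto
  have xr: "x = complex_of_real r \<odot>\<^bsub>H\<^esub> u"
    using xu by (simp add: r_def)
  have "A x = complex_of_real r \<odot>\<^bsub>H\<^esub> A u"
    unfolding xr using A u by (simp add: bounded_operators_def)
  then have "cip H (A x) x = complex_of_real r * (complex_of_real r * cip H (A u) u)"
    using u Ac[OF u(1)] by (simp add: xr cip_smult_left cip_smult_right smult_in_carrier)
  then have "cmod (cip H (A x) x) = cmod (cip H (A u) u) * r\<^sup>2"
    by (simp add: norm_mult power2_eq_square)
  then show ?thesis
    using mult_right_mono[OF le, of "r\<^sup>2"] by (simp add: r_def)
qed

lemma hnorm_le_operator_norm: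
  assumes K: "complex_hilbert_space K" and T: "T \<in> bounded_operators H K" and x: "x \<in> carrier H"
  shows "hnorm K (T x) \<le> operator_norm H K T * hnorm H x"
proof -
  interpret K: complex_hilbert_space K by (fact K)
  obtain C where C: "\<And>y. y \<in> carrier H \<Longrightarrow> hnorm K (T y) \<le> C * hnorm H y"
    using T unfolding bounded_operators_def by blast
  show ?thesis
  proof (cases "hnorm H x = 0")
    case True
    then show ?thesis using C[OF x] by simp
  next
    case False
    then obtain u where u: "u \<in> carrier H" "hnorm H u = 1"
      and xu: "x = complex_of_real (hnorm H x) \<odot>\<^bsub>H\<^esub> u"
      using normalize[OF x] by blast
    define r where "r = hnorm H x"
    \<comment> \<open>The supremum is over the whole unit ball, and \<open>C\<close> could be
      negative if \<open>H\<close> is the zero space; hence the absolute value.\<close>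
    have "hnorm K (T y) \<le> \<bar>C\<bar>" if "y \<in> carrier H" "hnorm H y \<le> 1" for y
    proof -
      have "C * hnorm H y \<le> \<bar>C\<bar> * 1"
        using that hnorm_ge_zero[OF that(1)] by (intro mult_mono) auto
      then show ?thesis using C[OF that(1)] by simp
    qed
    then have "bdd_above ((\<lambda>y. hnorm K (T y)) ` {y \<in> carrier H. hnorm H y \<le> 1})"
      by (auto intro!: bdd_aboveI[where M = "\<bar>C\<bar>"])
    then have le: "hnorm K (T u) \<le> operator_norm H K T"
      unfolding operator_norm_def using u by (intro cSUP_upper) auto
    have "x = complex_of_real r \<odot>\<^bsub>H\<^esub> u"
      using xu by (simp add: r_def)
    then have "T x = complex_of_real r \<odot>\<^bsub>K\<^esub> T u"
      using T u by (simp add: bounded_operators_def)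
    moreover have "T u \<in> carrier K"
      using T u by (auto simp: bounded_operators_def)
    ultimately have "hnorm K (T x) = r * hnorm K (T u)"
      using hnorm_ge_zero[OF x] by (simp add: K.hnorm_smult r_def)
    then show ?thesis
      using mult_left_mono[OF le hnorm_ge_zero[OF x]] by (simp add: r_def mult.commute)
  qed
qed

end

theorem theorem3p1:
  fixes n :: nat
    and H :: "nat \<Rightarrow> 'a complex_ip"
    and S :: "nat \<Rightarrow> 'a \<Rightarrow> 'a"
  assumes "n \<ge> 1"
    and "\<And>j. j \<in> {1..n} \<Longrightarrow> complex_hilbert_space (H j)"
    and "\<And>j. j \<in> {1..n} \<Longrightarrow> S j \<in> bounded_operators (H j) (H 1)"
  shows "numerical_radius (direct_sum {1..n} H)
           (operator_matrix {1..n} H (\<lambda>i j. if i = 1 then S j else (\<lambda>x. \<zero>\<^bsub>H i\<^esub>)))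
         \<le> 1 / 2 * (numerical_radius (H 1) (S 1)
             + sqrt ((numerical_radius (H 1) (S 1))\<^sup>2
                 + (\<Sum>j=2..n. (operator_norm (H j) (H 1) (S j))\<^sup>2)))"
    (is "numerical_radius ?D ?M \<le> ?rhs")
proof -
  define w where "w = numerical_radius (H 1) (S 1)"
  define N where "N j = operator_norm (H j) (H 1) (S j)" for j
  define v where "v = L2_set N {2..n}"
  have one: "1 \<in> {1..n}"
    using assms(1) by simp
  interpret H1: complex_hilbert_space "H 1"
    by (rule assms(2)[OF one])
  \<comment> \<open>The diagonal entry is separated from the rest of the row; for n = 1 the
    remaining sum is empty. The type is general because both real and complex sums are
    split.\<close>
  have split: "sum f {1..n} = f 1 + sum f {2..n}" for f :: "nat \<Rightarrow> 'c :: comm_monoid_add"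
    using assms(1) by (simp add: sum.atLeast_Suc_atMost numeral_2_eq_2)
  have rhs: "?rhs = 1 / 2 * (w + sqrt (w\<^sup>2 + v\<^sup>2))"
    by (simp add: w_def N_def v_def L2_set_def sum_nonneg)
  have unit: "cmod (cip ?D (?M x) x) \<le> ?rhs" if x: "x \<in> carrier ?D" "hnorm ?D x = 1" for x
  proof -
    have xj: "x j \<in> carrier (H j)" if "j \<in> {1..n}" for j
      using x(1) that by (auto simp: direct_sum_def)
    have Sxj: "S j (x j) \<in> carrier (H 1)" if "j \<in> {1..n}" for j
      using assms(3)[OF that] xj[OF that] by (auto simp: bounded_operators_def)
    define t where "t j = hnorm (H j) (x j)" for j
    define b where "b = L2_set t {2..n}"
    have "(\<Sum>j=1..n. (t j)\<^sup>2) = Re (cip ?D x x)"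
      by (simp add: direct_sum_def t_def complex_hilbert_space.hnorm_square[OF assms(2) xj])
    also have "\<dots> = 1"
      using x(2) by (simp add: hnorm_def)
    \<comment> \<open>Here \<open>t 1\<close> and \<open>b\<close> are the norms of the first
      component of \<open>x\<close> and of the remaining ones together.\<close>
    finally have ab: "(t 1)\<^sup>2 + b\<^sup>2 = 1"
      unfolding split by (simp add: b_def L2_set_def sum_nonneg)
    \<comment> \<open>Only the first component of the image can be nonzero, so the inner product on
      the direct sum reduces to one in \<open>H 1\<close>.\<close>
    have row: "cip (H i) (?M x i) (x i) = (if i = 1 then \<Sum>j=1..n. cip (H 1) (S j (x j)) (x 1) else 0)"
      if i: "i \<in> {1..n}" for i
    proof (cases "i = 1")
      case True
      then show ?thesis
        using H1.cip_finsum_left[of "{1..n}" "\<lambda>j. S j (x j)" "x 1"] Sxj xj[OF one] one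
        by (simp add: operator_matrix_def)
    next
      case False
      interpret Hi: complex_hilbert_space "H i"
        by (rule assms(2)[OF i])
      show ?thesis
        using False i Hi.cip_zero(1)[OF xj[OF i]] by (simp add: operator_matrix_def)
    qed
    have "cip ?D (?M x) x = (\<Sum>i=1..n. cip (H i) (?M x i) (x i))"
      by (simp add: direct_sum_def)
    also have "\<dots> = (\<Sum>i=1..n. if i = 1 then \<Sum>j=1..n. cip (H 1) (S j (x j)) (x 1) else 0)"
      by (intro sum.cong refl row)
    also have "\<dots> = (\<Sum>j=1..n. cip (H 1) (S j (x j)) (x 1))"
      using assms(1) by simp
    finally have eq: "cip ?D (?M x) x
        = cip (H 1) (S 1 (x 1)) (x 1) + (\<Sum>j=2..n. cip (H 1) (S j (x j)) (x 1))"
      by (simp only: split)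
    \<comment> \<open>Absolute values give the summands the form that
      \<open>L2_set_mult_ineq\<close>, Cauchy-Schwarz for finite real sums, bounds by
      \<open>v * b\<close>.\<close>
    have "cmod (\<Sum>j=2..n. cip (H 1) (S j (x j)) (x 1)) \<le> (\<Sum>j=2..n. t 1 * (\<bar>N j\<bar> * \<bar>t j\<bar>))"
    proof (rule sum_norm_le)
      fix j assume "j \<in> {2..n}"
      then have j: "j \<in> {1..n}" by simp
      interpret Hj: complex_hilbert_space "H j"
        by (rule assms(2)[OF j])
      have "hnorm (H 1) (S j (x j)) \<le> N j * t j"
        unfolding N_def t_def
        by (rule Hj.hnorm_le_operator_norm[OF H1.complex_hilbert_space_axioms assms(3)[OF j] xj[OF j]])
      also have "\<dots> \<le> \<bar>N j\<bar> * \<bar>t j\<bar>"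
        by (metis abs_ge_self abs_mult)
      finally have "hnorm (H 1) (S j (x j)) * t 1 \<le> (\<bar>N j\<bar> * \<bar>t j\<bar>) * t 1"
        using H1.hnorm_ge_zero[OF xj[OF one]] by (intro mult_right_mono) (auto simp: t_def)
      then show "cmod (cip (H 1) (S j (x j)) (x 1)) \<le> t 1 * (\<bar>N j\<bar> * \<bar>t j\<bar>)"
        using H1.cmod_cip_le[OF Sxj[OF j] xj[OF one]] by (simp add: t_def mult.commute)
    qed
    also have "\<dots> \<le> t 1 * (v * b)"
      unfolding sum_distrib_left[symmetric] v_def b_def
      using H1.hnorm_ge_zero[OF xj[OF one]]
      by (intro mult_left_mono L2_set_mult_ineq) (auto simp: t_def)
    finally have "cmod (\<Sum>j=2..n. cip (H 1) (S j (x j)) (x 1)) \<le> v * (t 1 * b)"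
      by (simp add: mult.left_commute)
    moreover have "cmod (cip (H 1) (S 1 (x 1)) (x 1)) \<le> w * (t 1)\<^sup>2"
      unfolding w_def t_def by (rule H1.numerical_radius_upper[OF assms(3)[OF one] xj[OF one]])
    ultimately have "cmod (cip ?D (?M x) x) \<le> w * (t 1)\<^sup>2 + v * (t 1 * b)"
      unfolding eq by (intro norm_triangle_le) simp
    also have "\<dots> \<le> ?rhs"
      unfolding rhs by (rule quadratic_form_bound[OF ab])
    finally show ?thesis .
  qed
  \<comment> \<open>The inserted 0 in \<open>numerical_radius\<close> must also lie below the bound;
    at a = 0, b = 1 the left side of \<open>quadratic_form_bound\<close> vanishes.\<close>
  have "0 \<le> ?rhs"
    unfolding rhs using quadratic_form_bound[of 0 1 w v] by simp
  then show ?thesis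
    unfolding numerical_radius_def[of ?D] using unit by (intro cSup_least) auto
qed

end
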